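(* A separable Banach space $X$ has a Schauder frame if and only if it has the bounded approximation property.
   Context: Banach spaces are over $\mathbb{K}\in\{\mathbb{R},\mathbb{C}\}$; $X^*$ denotes the topological dual of $X$. A Schauder frame of $X$ is a sequence $\{(x_n,f_n)\}_{n\ge 1}\subset X\times X^*$ such that for every $x\in X$ the series $\sum_n f_n(x)x_n$ converges in norm to $x$. $X$ has the bounded approximation property if there is $\lambda\ge 1$ such that for every compact $K\subset X$ and every $\varepsilon>0$ there is a finite rank bounded linear operator $T:X\to X$ with $\|T\|\le\lambda$ and $\|Tx-x\|\le\varepsilon$ for all $x\in K$. *)

theory Defs
  imports "HOL-Analysis.Analysis"
begin

text \<open>
  The type class \<^class>\<open>banach\<close> provides real Banach spaces only. A Banach space over
  the scalar field \<open>'k\<close> is therefore a type of that class together with a scalar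
  multiplication by \<open>'k\<close> that extends the real one and for which the norm is homogeneous.
  The relevant cases are \<open>'k\<close> = \<^typ>\<open>real\<close> and \<^typ>\<open>complex\<close>; every
  complex Banach space arises in this way from its underlying real Banach space.
\<close>

locale banach_over = vector_space sc
  for sc :: "'k::real_normed_field \<Rightarrow> 'a::banach \<Rightarrow> 'a" +
  assumes scale_of_real: "sc (of_real r) x = r *\<^sub>R x"
    and norm_scale: "norm (sc c x) = norm c * norm x"

lemma banach_over_real: "banach_over (scaleR :: real \<Rightarrow> 'a::banach \<Rightarrow> 'a)"
  by unfold_locales (auto simp: algebra_simps)

lemma banach_over_complex: "banach_over ((*) :: complex \<Rightarrow> complex \<Rightarrow> complex)"
  by unfold_locales (auto simp: algebra_simps scaleR_conv_of_real norm_mult)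

definition topological_dual :: "('k::real_normed_field \<Rightarrow> 'a::banach \<Rightarrow> 'a) \<Rightarrow> ('a \<Rightarrow> 'k) set"
  where "topological_dual sc =
    {f. Vector_Spaces.linear sc (*) f \<and> continuous_on UNIV f}"

text \<open>Frames are indexed from 0.\<close>

definition schauder_frame ::
  "('k::real_normed_field \<Rightarrow> 'a::banach \<Rightarrow> 'a) \<Rightarrow> (nat \<Rightarrow> 'a \<times> ('a \<Rightarrow> 'k)) \<Rightarrow> bool"
  where "schauder_frame sc F \<longleftrightarrow>
    (\<forall>n. snd (F n) \<in> topological_dual sc) \<and>
    (\<forall>x. (\<lambda>n. sc (snd (F n) x) (fst (F n))) sums x)"

text \<open>
  A finite rank operator is one whose range is the span, over \<open>'k\<close>, of a finite set. Boundedness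
  (and the operator norm \<^const>\<open>onorm\<close>) do not depend on the scalar field, so the real notion
  \<^const>\<open>bounded_linear\<close> serves here; linearity over \<open>'k\<close> is demanded separately.
\<close>

definition finite_rank_operator ::
  "('k::real_normed_field \<Rightarrow> 'a::banach \<Rightarrow> 'a) \<Rightarrow> ('a \<Rightarrow> 'a) \<Rightarrow> bool"
  where "finite_rank_operator sc T \<longleftrightarrow>
    Vector_Spaces.linear sc sc T \<and> bounded_linear T \<and>
    (\<exists>B. finite B \<and> range T = module.span sc B)"

definition bounded_approximation_property ::
  "('k::real_normed_field \<Rightarrow> 'a::banach \<Rightarrow> 'a) \<Rightarrow> bool"
  where "bounded_approximation_property sc \<longleftrightarrow>
    (\<exists>M\<ge>1. \<forall>K. compact K \<longrightarrow> (\<forall>\<epsilon>>0.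
      \<exists>T. finite_rank_operator sc T \<and> onorm T \<le> M \<and> (\<forall>x\<in>K. norm (T x - x) \<le> \<epsilon>)))"

end

theory Submission
  imports Defs
begin

text \<open>
  A Schauder frame gives bounded approximation because its partial sum operators have finite rank
  and converge pointwise to the identity. By the uniform boundedness principle
  (\<open>uniformly_bounded_of_pointwise_bounded\<close>) their norms have a common bound, and for a sequence
  bounded in norm pointwise convergence is uniform on compact sets.

  Conversely, bounded approximation on finite subsets of a countable dense set yields finite rank
  operators \<open>U\<^sub>n\<close> that converge pointwise to the identity, hence \<open>x = \<Sum>\<^sub>n A\<^sub>n x\<close> with
  \<open>A\<^sub>n = U\<^bsub>n+1\<^esub> - U\<^sub>n\<close>. It remains to split every \<open>A\<^sub>n\<close> into rank one operators without
  destroying convergence. A basis of a finite-dimensional space containing the range of \<open>A\<^sub>n\<close> gives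
  \<open>A\<^sub>n x = \<Sum>\<^sub>i f\<^sub>i(x) e\<^sub>i\<close> with continuous \<open>f\<^sub>i\<close>, but the partial sums of this expansion can be large
  compared with \<open>A\<^sub>n x\<close>. The idea, due to Pelczynski, is to divide the expansion by a large number
  \<open>N\<close> and to run through it \<open>N\<close> times: after some complete rounds the partial sum is
  \<open>t A\<^sub>n x\<close> with \<open>0 \<le> t \<le> 1\<close>, and the incomplete round contributes only \<open>O(\<parallel>x\<parallel> / N)\<close>
  (\<open>finite_rank_expansion_small_partial_sums\<close>). A frame may repeat
  vectors, so these blocks can simply be concatenated for \<open>n = 0, 1, \<dots>\<close>. The partial sums inside
  block \<open>n\<close> are at most \<open>\<parallel>A\<^sub>n x\<parallel> + \<parallel>x\<parallel> / (n + 1)\<close>, which tends to \<open>0\<close>, so the series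
  converges to \<open>x\<close> (\<open>sums_of_block_sums\<close>).
\<close>

section \<open>Uniform boundedness\<close>

text \<open>
  The Banach-Steinhaus theorem. By Baire's theorem one of the closed sets \<open>V k\<close>, on which all
  \<open>S n\<close> are bounded by \<open>k\<close>, contains a ball; translating the ball to the origin and scaling
  gives a bound on the whole space.
\<close>

lemma uniformly_bounded_of_pointwise_bounded:
  fixes S :: "nat \<Rightarrow> 'a::banach \<Rightarrow> 'b::real_normed_vector"
  assumes lin: "\<And>n. linear (S n)"
    and cont: "\<And>n. continuous_on UNIV (S n)"
    and bdd: "\<And>x. \<exists>k. \<forall>n. norm (S n x) \<le> k"
  shows "\<exists>C>0. \<forall>n x. norm (S n x) \<le> C * norm x"
proof -
  define V where "V k = {x. \<forall>n. norm (S n x) \<le> real k}" for k :: nat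
  have clo: "closed (V k)" for k
    unfolding V_def
    by (intro closed_Collect_all closed_Collect_le continuous_on_norm cont continuous_on_const)
  have cover: "(\<Union>k. V k) = UNIV"
  proof -
    have "\<exists>k. x \<in> V k" for x
    proof -
      obtain c where "\<forall>n. norm (S n x) \<le> c" using bdd by blast
      moreover obtain k :: nat where "c \<le> real k" using real_arch_simple by blast
      ultimately show ?thesis unfolding V_def by (auto intro: order_trans)
    qed
    then show ?thesis by blast
  qed
  have "\<exists>k. interior (V k) \<noteq> {}"
  proof (rule ccontr)
    assume "\<nexists>k. interior (V k) \<noteq> {}"
    then have "(euclidean :: 'a topology) interior_of \<Union>(range V) = {}"
      using clo by (intro Baire_category_alt) (auto simp: completely_metrizable_space_euclidean)
    then show False using cover by simp
  qed
  then obtain k x0 where "x0 \<in> interior (V k)" by blast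
  then obtain r where r: "r > 0" "ball x0 r \<subseteq> V k"
    using mem_interior by blast
  have near_zero: "norm (S n y) \<le> 2 * real k" if "norm y < r" for n y
  proof -
    have "x0 + y \<in> V k" "x0 \<in> V k" using r that by (auto simp: subset_iff dist_norm)
    then have "norm (S n (x0 + y)) \<le> k" "norm (S n x0) \<le> k" unfolding V_def by auto
    moreover have "S n y = S n (x0 + y) - S n x0" using lin by (simp add: linear_add)
    ultimately show ?thesis by (smt (verit) norm_triangle_ineq4)
  qed
  have "norm (S n x) \<le> (4 * real k + 1) / r * norm x" for n x
  proof (cases "x = 0")
    case True
    then show ?thesis using linear_0[OF lin] by simp
  next
    case False
    define c where "c = r / (2 * norm x)"
    have "c > 0" using False r c_def by simp
    have "norm (c *\<^sub>R x) < r" using False r by (simp add: c_def)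
    then have "c * norm (S n x) \<le> 2 * real k"
      using near_zero[of "c *\<^sub>R x" n] \<open>c > 0\<close> by (simp add: linear_scale[OF lin])
    then have "norm (S n x) \<le> 2 * real k / c" using \<open>c > 0\<close> by (simp add: field_simps)
    also have "\<dots> = 4 * real k / r * norm x" using False r by (simp add: c_def field_simps)
    also have "\<dots> \<le> (4 * real k + 1) / r * norm x"
      using r by (intro mult_right_mono divide_right_mono) auto
    finally show ?thesis .
  qed
  then show ?thesis using r by (intro exI[of _ "(4 * real k + 1) / r"]) auto
qed

section \<open>Concatenating finite blocks\<close>

lemma strict_mono_partial_sums:
  fixes l :: "nat \<Rightarrow> nat"
  assumes "\<And>n. 0 < l n"
  shows "strict_mono (\<lambda>n. \<Sum>j<n. l j)"
  using assms by (intro strict_monoI_Suc) simp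

lemma sum_lessThan_add:
  fixes g :: "nat \<Rightarrow> 'a::comm_monoid_add"
  shows "(\<Sum>i<p + q. g i) = (\<Sum>i<p. g i) + (\<Sum>i<q. g (p + i))"
  by (induction q) (auto simp: add.assoc)

text \<open>
  Block \<open>n\<close> occupies the \<open>l n\<close> positions from \<open>\<Sum>j<n. l j\<close> on. The first conclusion lets properties
  common to all \<open>P n i\<close> pass to \<open>F\<close> without locating the block of an index.
\<close>

lemma concatenate_blocks:
  fixes l :: "nat \<Rightarrow> nat" and P :: "nat \<Rightarrow> nat \<Rightarrow> 'a"
  assumes "\<And>n. 0 < l n"
  obtains F where "\<And>k. \<exists>n i. F k = P n i"
    and "\<And>n i. i < l n \<Longrightarrow> F ((\<Sum>j<n. l j) + i) = P n i"
proof
  define b where "b n = (\<Sum>j<n. l j)" for n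
  have mono: "strict_mono b" unfolding b_def by (rule strict_mono_partial_sums[OF assms])
  define N where "N k = (LEAST n. k < b (Suc n))" for k
  define F where "F k = P (N k) (k - b (N k))" for k
  show "\<exists>n i. F k = P n i" for k unfolding F_def by blast
  show "F ((\<Sum>j<n. l j) + i) = P n i" if "i < l n" for n i
  proof -
    have "N (b n + i) = n"
      unfolding N_def
    proof (rule Least_equality)
      show "b n + i < b (Suc n)" using that by (simp add: b_def)
      show "n \<le> m" if "b n + i < b (Suc m)" for m
        using that strict_mono_less[OF mono, of n "Suc m"] by linarith
    qed
    then show ?thesis by (simp add: F_def b_def)
  qed
qed

text \<open>
  Convergence at the block boundaries suffices, because any other partial sum differs from the one
  at the preceding boundary by an initial piece of a block, and these pieces tend to \<open>0\<close>.
\<close>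

lemma sums_of_block_sums:
  fixes g :: "nat \<Rightarrow> 'a::real_normed_vector" and l :: "nat \<Rightarrow> nat"
  assumes pos: "\<And>n. 0 < l n"
    and lim: "(\<lambda>n. \<Sum>i<(\<Sum>j<n. l j). g i) \<longlonglongrightarrow> x"
    and within: "\<And>n k. k \<le> l n \<Longrightarrow> norm (\<Sum>i<k. g ((\<Sum>j<n. l j) + i)) \<le> e n"
    and e: "e \<longlonglongrightarrow> 0"
  shows "g sums x"
  unfolding sums_def
proof (rule LIMSEQ_I)
  define b where "b n = (\<Sum>j<n. l j)" for n
  have mono: "strict_mono b" unfolding b_def by (rule strict_mono_partial_sums[OF pos])
  have locate: "\<exists>n. b n \<le> k \<and> k < b (Suc n)" for k
  proof (induction k)
    case 0
    show ?case using pos[of 0] by (intro exI[of _ 0]) (simp add: b_def)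
  next
    case (Suc k)
    then obtain n where "b n \<le> k" "k < b (Suc n)" by blast
    moreover have "b (Suc n) < b (Suc (Suc n))" using mono by (simp add: strict_mono_less)
    ultimately show ?case
      by (cases "Suc k < b (Suc n)") (auto intro: exI[of _ n] exI[of _ "Suc n"])
  qed
  fix r :: real assume "0 < r"
  then obtain N1 N2 where N1: "\<And>n. n \<ge> N1 \<Longrightarrow> norm ((\<Sum>i<b n. g i) - x) < r / 2"
    and N2: "\<And>n. n \<ge> N2 \<Longrightarrow> norm (e n) < r / 2"
    using LIMSEQ_D[OF lim, of "r / 2"] LIMSEQ_D[OF e, of "r / 2"] unfolding b_def by auto
  define N where "N = max N1 N2"
  have "norm ((\<Sum>i<k. g i) - x) < r" if "k \<ge> b N" for k
  proof -
    obtain n where n: "b n \<le> k" "k < b (Suc n)" using locate by blast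
    then have "N \<le> n" using that strict_mono_less[OF mono, of N "Suc n"] by linarith
    have k: "k = b n + (k - b n)" "k - b n \<le> l n" using n by (auto simp: b_def)
    have "(\<Sum>i<k. g i) - x = ((\<Sum>i<b n. g i) - x) + (\<Sum>i<k - b n. g (b n + i))"
      by (subst k(1), subst sum_lessThan_add) simp
    also have "norm \<dots> < r / 2 + r / 2"
    proof (rule norm_triangle_lt, rule add_strict_mono)
      show "norm ((\<Sum>i<b n. g i) - x) < r / 2" using N1 \<open>N \<le> n\<close> N_def by simp
      have "norm (\<Sum>i<k - b n. g (b n + i)) \<le> e n" using within k(2) unfolding b_def by blast
      also have "\<dots> < r / 2" using N2[of n] \<open>N \<le> n\<close> N_def by simp
      finally show "norm (\<Sum>i<k - b n. g (b n + i)) < r / 2" .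
    qed
    finally show ?thesis by simp
  qed
  then show "\<exists>no. \<forall>k\<ge>no. norm ((\<Sum>i<k. g i) - x) < r" by blast
qed

text \<open>
  Running cyclically through \<open>g 0, \<dots>, g (m - 1)\<close> for \<open>k\<close> steps: the complete rounds and the
  incomplete last one.
\<close>

lemma sum_mod_eq:
  fixes g :: "nat \<Rightarrow> 'a::real_vector"
  assumes "0 < m"
  shows "(\<Sum>i<k. g (i mod m)) = real (k div m) *\<^sub>R (\<Sum>i<m. g i) + (\<Sum>i<k mod m. g i)"
proof (induction k)
  case 0
  show ?case by simp
next
  case (Suc k)
  show ?case
  proof (cases "Suc (k mod m) = m")
    case True
    then have "Suc k div m = Suc (k div m)" "Suc k mod m = 0"
      by (auto simp: div_Suc mod_Suc)
    moreover have "(\<Sum>i<m. g i) = (\<Sum>i<k mod m. g i) + g (k mod m)"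
      by (subst True[symmetric]) simp
    ultimately show ?thesis using Suc by (simp add: scaleR_add_left algebra_simps)
  next
    case False
    then have "Suc k div m = k div m" "Suc k mod m = Suc (k mod m)"
      by (auto simp: div_Suc mod_Suc)
    then show ?thesis using Suc by simp
  qed
qed

section \<open>Operators with finite-dimensional range\<close>

context banach_over
begin

lemma bounded_linear_scale_left: "bounded_linear (\<lambda>c. sc c x)"
proof (rule bounded_linear_intro[where K = "norm x"])
  show "sc (r *\<^sub>R c) x = r *\<^sub>R sc c x" for r c
    by (simp add: scaleR_conv_of_real scale_of_real flip: scale_scale)
qed (simp_all add: scale_left_distrib norm_scale)

lemma bounded_linear_scale_right: "bounded_linear (sc c)"
proof (rule bounded_linear_intro[where K = "norm c"])
  show "sc c (r *\<^sub>R x) = r *\<^sub>R sc c x" for r x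
    by (metis scale_of_real scale_left_commute)
qed (simp_all add: scale_right_distrib norm_scale mult.commute)

lemma linear_of_scalar_linear:
  assumes "Vector_Spaces.linear sc sc T"
  shows "linear T"
  using assms by (intro linearI) (auto simp: Vector_Spaces.linear_iff simp flip: scale_of_real)

text \<open>
  An inclusion of the range in a finitely generated span is what sums and differences of finite rank
  operators give directly; equality with a span follows by choosing a basis inside the range.
\<close>

lemma finite_rank_operatorI:
  assumes T: "Vector_Spaces.linear sc sc T" "bounded_linear T"
    and B: "finite B" "range T \<subseteq> module.span sc B"
  shows "finite_rank_operator sc T"
proof -
  interpret T: Vector_Spaces.linear sc sc T by fact
  obtain C where C: "C \<subseteq> range T" "independent C" "range T \<subseteq> span C"
    using maximal_independent_subset by blast
  have "finite C" using independent_span_bound[OF B(1) C(2)] C(1) B(2) by blast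
  moreover have "span C \<subseteq> range T"
    using C(1) T.subspace_image[OF subspace_UNIV] by (rule span_minimal)
  ultimately show ?thesis unfolding finite_rank_operator_def using T C(3) by blast
qed

end

text \<open>
  Coordinates in a finite-dimensional subspace are continuous because the scalar field is complete;
  \<^typ>\<open>real\<close> and \<^typ>\<open>complex\<close> are the fields of interest.
\<close>

locale complete_banach_over = banach_over sc
  for sc :: "'k::{real_normed_field,banach} \<Rightarrow> 'a::banach \<Rightarrow> 'a"
begin

text \<open>
  By induction on the dimension. A convergent sequence in the span of \<open>B\<close> has Cauchy
  coefficients by the bound for \<open>B\<close>, so its limit is again in the span. A new basis vector \<open>b0\<close>
  therefore has a positive distance \<open>d\<close> from the span of \<open>B\<close>, and the norm of \<open>a b0 + y\<close>, with
  \<open>y\<close> in that span, is at least \<open>\<bar>a\<bar> d\<close>. This bounds the coefficient of \<open>b0\<close>, hence the norm of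
  the remaining part \<open>y\<close>, to which the bound for \<open>B\<close> applies.
\<close>

lemma coefficients_bounded_by_norm:
  assumes "finite B" "independent B"
  shows "\<exists>C>0. \<forall>a. \<forall>b\<in>B. norm (a b) \<le> C * norm (\<Sum>b\<in>B. sc (a b) b)"
  using assms
proof (induction B)
  case empty
  show ?case by (intro exI[of _ 1]) simp
next
  case (insert b0 B)
  have ind: "independent B" and b0: "b0 \<notin> span B"
    using insert.prems insert.hyps by (auto simp: independent_insert)
  obtain C where "C > 0" and C: "\<And>a b. b \<in> B \<Longrightarrow> norm (a b) \<le> C * norm (\<Sum>b\<in>B. sc (a b) b)"
    using insert.IH[OF ind] by blast
  have "\<exists>d>0. \<forall>a. d \<le> norm (b0 - (\<Sum>b\<in>B. sc (a b) b))"
  proof (rule ccontr)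
    assume "\<not> ?thesis"
    then have "\<forall>n. \<exists>a. norm (b0 - (\<Sum>b\<in>B. sc (a b) b)) < 1 / real (Suc n)"
      by (metis not_le of_nat_0_less_iff zero_less_Suc zero_less_divide_1_iff)
    then obtain a where a: "\<And>n. norm (b0 - (\<Sum>b\<in>B. sc (a n b) b)) < 1 / real (Suc n)"
      by metis
    define y where "y n = (\<Sum>b\<in>B. sc (a n b) b)" for n
    have "(\<lambda>n. b0 - y n) \<longlonglongrightarrow> 0"
    proof (rule Lim_null_comparison)
      show "\<forall>\<^sub>F n in sequentially. norm (b0 - y n) \<le> 1 / real (Suc n)"
        using a less_imp_le unfolding y_def by (intro always_eventually) blast
      show "(\<lambda>n. 1 / real (Suc n)) \<longlonglongrightarrow> 0" using LIMSEQ_inverse_real_of_nat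
        by (simp add: inverse_eq_divide)
    qed
    then have lim: "y \<longlonglongrightarrow> b0"
      using tendsto_diff[OF tendsto_const[of b0]] by fastforce
    have "Cauchy (\<lambda>n. a n b)" if "b \<in> B" for b
    proof (rule metric_CauchyI)
      fix r :: real assume "r > 0"
      then obtain N where N: "\<And>m n. m \<ge> N \<Longrightarrow> n \<ge> N \<Longrightarrow> dist (y m) (y n) < r / C"
        using metric_CauchyD[OF LIMSEQ_imp_Cauchy[OF lim], of "r / C"] \<open>C > 0\<close> by auto
      have "dist (a m b) (a n b) < r" if "m \<ge> N" "n \<ge> N" for m n
      proof -
        have "norm (a m b - a n b) \<le> C * norm (y m - y n)"
          using C[OF \<open>b \<in> B\<close>, of "\<lambda>b. a m b - a n b"]
          by (simp add: y_def scale_left_diff_distrib sum_subtractf)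
        also have "\<dots> < r" using N[OF that] \<open>C > 0\<close> by (simp add: dist_norm field_simps)
        finally show ?thesis by (simp add: dist_norm)
      qed
      then show "\<exists>M. \<forall>m\<ge>M. \<forall>n\<ge>M. dist (a m b) (a n b) < r" by blast
    qed
    then have "\<forall>b\<in>B. \<exists>c. (\<lambda>n. a n b) \<longlonglongrightarrow> c"
      using Cauchy_convergent convergent_def by blast
    then obtain c where c: "\<And>b. b \<in> B \<Longrightarrow> (\<lambda>n. a n b) \<longlonglongrightarrow> c b" by metis
    have "y \<longlonglongrightarrow> (\<Sum>b\<in>B. sc (c b) b)"
      unfolding y_def
      by (intro tendsto_sum bounded_linear.tendsto[OF bounded_linear_scale_left] c)
    with lim have "b0 = (\<Sum>b\<in>B. sc (c b) b)" by (rule LIMSEQ_unique)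
    also have "\<dots> \<in> span B" by (intro span_sum span_scale span_base)
    finally show False using b0 by blast
  qed
  then obtain d where "d > 0" and d: "\<And>a. d \<le> norm (b0 - (\<Sum>b\<in>B. sc (a b) b))" by blast
  (* The first term bounds the coefficient of b0, the second one the coefficients over B. *)
  define C' where "C' = max (1 / d) (C * (1 + norm b0 / d))"
  have "norm (a b) \<le> C' * norm (\<Sum>b\<in>insert b0 B. sc (a b) b)" if "b \<in> insert b0 B" for a b
  proof -
    define y where "y = (\<Sum>b\<in>B. sc (a b) b)"
    define v where "v = sc (a b0) b0 + y"
    have v: "(\<Sum>b\<in>insert b0 B. sc (a b) b) = v" using insert.hyps by (simp add: v_def y_def)
    have a0: "norm (a b0) \<le> 1 / d * norm v"
    proof (cases "a b0 = 0")
      case False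
      have "y = sc (a b0) (\<Sum>b\<in>B. sc (a b / a b0) b)"
        using False by (simp add: y_def scale_sum_right)
      then have "v = sc (a b0) (b0 - (\<Sum>b\<in>B. sc (- (a b / a b0)) b))"
        by (simp add: v_def scale_right_distrib scale_right_diff_distrib sum_negf)
      then have "norm v = norm (a b0) * norm (b0 - (\<Sum>b\<in>B. sc (- (a b / a b0)) b))"
        by (simp only: norm_scale)
      also have "\<dots> \<ge> norm (a b0) * d" by (intro mult_left_mono d) auto
      finally show ?thesis using \<open>d > 0\<close> by (simp add: field_simps)
    qed (use \<open>d > 0\<close> in simp)
    have le: "1 / d * norm v \<le> C' * norm v" "C * (1 + norm b0 / d) * norm v \<le> C' * norm v"
      unfolding C'_def by (intro mult_right_mono; simp)+
    show ?thesis
    proof (cases "b = b0")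
      case True
      then show ?thesis using a0 le(1) v by simp
    next
      case False
      then have "norm (a b) \<le> C * norm y" using C that by (simp add: y_def)
      also have "\<dots> \<le> C * (norm v + norm (sc (a b0) b0))"
        using \<open>C > 0\<close> norm_triangle_ineq4[of v "sc (a b0) b0"]
        by (intro mult_left_mono) (auto simp: v_def)
      also have "\<dots> \<le> C * (norm v + 1 / d * norm v * norm b0)"
        using \<open>C > 0\<close> mult_right_mono[OF a0, of "norm b0"]
        by (intro mult_left_mono add_left_mono) (auto simp: norm_scale)
      also have "\<dots> = C * (1 + norm b0 / d) * norm v" by (simp add: algebra_simps)
      finally show ?thesis using le(2) v by simp
    qed
  qed
  moreover have "C' > 0" using \<open>d > 0\<close> by (simp add: C'_def less_max_iff_disj)
  ultimately show ?case by blast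
qed

text \<open>
  The functionals are the coordinates of \<open>A x\<close> in a basis of the span of \<open>B0\<close>; they are continuous by
  \<open>coefficients_bounded_by_norm\<close>.
\<close>

lemma finite_rank_expansion:
  assumes A: "Vector_Spaces.linear sc sc A" "bounded_linear A"
    and B0: "finite B0" "range A \<subseteq> module.span sc B0"
  obtains m :: nat and e f D where "0 < m" "0 \<le> D"
    and "\<And>i. f i \<in> topological_dual sc"
    and "\<And>x. A x = (\<Sum>i<m. sc (f i x) (e i))"
    and "\<And>i x. i < m \<Longrightarrow> norm (sc (f i x) (e i)) \<le> D * norm x"
proof -
  interpret A: Vector_Spaces.linear sc sc A by fact
  obtain B where B: "B \<subseteq> B0" "independent B" "B0 \<subseteq> span B"
    using maximal_independent_subset by blast
  have "finite B" using B(1) B0(1) finite_subset by blast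
  have inB: "A x \<in> span B" for x
    using B0(2) span_minimal[OF B(3) subspace_span] by blast
  define h where "h b x = representation B (A x) b" for b x
  have expand: "A x = (\<Sum>b\<in>B. sc (h b x) b)" for x
    unfolding h_def using sum_representation_eq[OF B(2) inB \<open>finite B\<close> order_refl] by simp
  obtain C where "C > 0" and C: "\<And>a b. b \<in> B \<Longrightarrow> norm (a b) \<le> C * norm (\<Sum>b\<in>B. sc (a b) b)"
    using coefficients_bounded_by_norm[OF \<open>finite B\<close> B(2)] by blast
  obtain K where "K > 0" and K: "\<And>x. norm (A x) \<le> norm x * K"
    using bounded_linear.pos_bounded[OF A(2)] by blast
  have hbound: "norm (h b x) \<le> (C * K) * norm x" for b x
  proof (cases "b \<in> B")
    case True
    then have "norm (h b x) \<le> C * norm (A x)" using C[of b "\<lambda>b. h b x"] expand by simp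
    also have "\<dots> \<le> C * (norm x * K)" using \<open>C > 0\<close> K by (intro mult_left_mono) auto
    finally show ?thesis by (simp add: mult_ac)
  next
    case False
    then have "h b x = 0" unfolding h_def using representation_ne_zero by blast
    then show ?thesis using \<open>C > 0\<close> \<open>K > 0\<close> by simp
  qed
  have hadd: "h b (x + y) = h b x + h b y" for b x y
    unfolding h_def by (simp add: A.add representation_add[OF B(2) inB inB])
  have hscale: "h b (sc c x) = c * h b x" for b c x
    unfolding h_def by (simp add: A.scale representation_scale[OF B(2) inB])
  have hdual: "h b \<in> topological_dual sc" for b
  proof -
    have "bounded_linear (h b)"
    proof (rule bounded_linear_intro)
      show "h b (r *\<^sub>R x) = r *\<^sub>R h b x" for r x
        by (simp add: hscale scaleR_conv_of_real flip: scale_of_real)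
      show "norm (h b x) \<le> norm x * (C * K)" for x using hbound by (simp add: mult.commute)
    qed (rule hadd)
    moreover have "Vector_Spaces.linear sc (*) (h b)"
      unfolding Vector_Spaces.linear_iff by (auto simp: hadd hscale vector_space_axioms)
         (unfold_locales; simp add: algebra_simps)
    ultimately show ?thesis
      unfolding topological_dual_def by (simp add: linear_continuous_on)
  qed
  obtain bs where bs: "set bs = B" "distinct bs"
    using finite_distinct_list[OF \<open>finite B\<close>] by blast
  define m where "m = length bs"
  (* One vector 0 is appended to the basis so that the expansion has a term even if the
     basis is empty; the coordinate along a vector outside the basis is 0. *)
  define e where "e i = (if i < m then bs ! i else 0)" for i
  show ?thesis
  proof
    show "0 < Suc m" by simp
    show "0 \<le> C * K * (\<Sum>i<Suc m. norm (e i))"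
      using \<open>C > 0\<close> \<open>K > 0\<close> by (intro mult_nonneg_nonneg sum_nonneg) auto
    show "h (e i) \<in> topological_dual sc" for i by (rule hdual)
    show "A x = (\<Sum>i<Suc m. sc (h (e i) x) (e i))" for x
    proof -
      have "bij_betw (\<lambda>i. bs ! i) {..<m} B"
        using bs by (intro bij_betw_nth) (auto simp: m_def)
      then have "(\<Sum>i<m. sc (h (bs ! i) x) (bs ! i)) = (\<Sum>b\<in>B. sc (h b x) b)"
        by (rule sum.reindex_bij_betw)
      then show ?thesis unfolding expand[of x] by (simp add: e_def)
    qed
    show "norm (sc (h (e i) x) (e i)) \<le> C * K * (\<Sum>i<Suc m. norm (e i)) * norm x"
      if "i < Suc m" for i x
    proof -
      have "norm (e i) \<le> (\<Sum>i<Suc m. norm (e i))"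
        using that by (intro member_le_sum) auto
      then have "norm (h (e i) x) * norm (e i) \<le> (C * K * norm x) * (\<Sum>i<Suc m. norm (e i))"
        using hbound by (intro mult_mono) (auto simp: \<open>C > 0\<close> \<open>K > 0\<close> less_imp_le)
      then show ?thesis by (simp add: norm_scale mult_ac)
    qed
  qed
qed

text \<open>
  The averaging step. With an expansion of \<open>m\<close> terms, each at most \<open>D * norm x\<close>, repeated \<open>N\<close>
  times with the factor \<open>1 / N\<close>, a partial sum is a multiple of \<open>A x\<close> by a factor in \<open>[0, 1]\<close> plus
  fewer than \<open>m\<close> terms of size \<open>D * norm x / N\<close>.
\<close>

lemma finite_rank_expansion_small_partial_sums:
  assumes A: "Vector_Spaces.linear sc sc A" "bounded_linear A"
    and B: "finite B" "range A \<subseteq> module.span sc B"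
    and "0 < \<epsilon>"
  obtains l :: nat and e f where "0 < l"
    and "\<And>i. f i \<in> topological_dual sc"
    and "\<And>x. A x = (\<Sum>i<l. sc (f i x) (e i))"
    and "\<And>k x. k \<le> l \<Longrightarrow> norm (\<Sum>i<k. sc (f i x) (e i)) \<le> norm (A x) + \<epsilon> * norm x"
proof -
  obtain m :: nat and e f D where "0 < m" "0 \<le> D"
    and dual: "\<And>i. f i \<in> topological_dual sc"
    and expand: "\<And>x. A x = (\<Sum>i<m. sc (f i x) (e i))"
    and D: "\<And>i x. i < m \<Longrightarrow> norm (sc (f i x) (e i)) \<le> D * norm x"
    by (rule finite_rank_expansion[OF A B]) (rule that)
  (* N is so large that an incomplete round, at most m * D / N * norm x, stays below \<epsilon> * norm x. *)
  obtain N0 :: nat where "m * D / \<epsilon> < real N0" using reals_Archimedean2 by blast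
  define N where "N = Suc N0"
  have "0 < N" by (simp add: N_def)
  have "m * D / \<epsilon> \<le> real N" using \<open>m * D / \<epsilon> < real N0\<close> by (simp add: N_def)
  then have N: "m * D / N \<le> \<epsilon>" using \<open>0 < \<epsilon>\<close> \<open>0 < N\<close> by (simp add: field_simps)
  define e' where "e' i = (1 / real N) *\<^sub>R e (i mod m)" for i
  have partial: "(\<Sum>i<k. sc (f (i mod m) x) (e' i)) =
      (real (k div m) / N) *\<^sub>R A x + (1 / real N) *\<^sub>R (\<Sum>i<k mod m. sc (f i x) (e i))" for k x
  proof -
    have "sc (f (i mod m) x) (e' i) = (1 / real N) *\<^sub>R sc (f (i mod m) x) (e (i mod m))" for i
      unfolding e'_def by (rule linear_scale[OF bounded_linear.linear[OF bounded_linear_scale_right]])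
    then have "(\<Sum>i<k. sc (f (i mod m) x) (e' i)) =
        (1 / real N) *\<^sub>R (\<Sum>i<k. sc (f (i mod m) x) (e (i mod m)))"
      by (simp add: scaleR_sum_right)
    also have "\<dots> = (1 / real N) *\<^sub>R (real (k div m) *\<^sub>R A x + (\<Sum>i<k mod m. sc (f i x) (e i)))"
      by (simp add: sum_mod_eq[OF \<open>0 < m\<close>, of "\<lambda>i. sc (f i x) (e i)"] expand)
    finally show ?thesis by (simp add: scaleR_add_right)
  qed
  show ?thesis
  proof
    show "0 < N * m" using \<open>0 < N\<close> \<open>0 < m\<close> by simp
    show "f (i mod m) \<in> topological_dual sc" for i by (rule dual)
    show "A x = (\<Sum>i<N * m. sc (f (i mod m) x) (e' i))" for x
      unfolding partial using \<open>0 < N\<close> \<open>0 < m\<close> by simp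
    show "norm (\<Sum>i<k. sc (f (i mod m) x) (e' i)) \<le> norm (A x) + \<epsilon> * norm x"
      if "k \<le> N * m" for k x
      unfolding partial
    proof (rule norm_triangle_le, rule add_mono)
      have "k div m \<le> N" using that div_le_mono[of k "N * m" m] \<open>0 < m\<close> by simp
      then have "real (k div m) / N \<le> 1" using \<open>0 < N\<close> by simp
      then show "norm ((real (k div m) / N) *\<^sub>R A x) \<le> norm (A x)"
        using mult_right_mono[of "real (k div m) / N" 1 "norm (A x)"] by simp
      have "k mod m < m" using \<open>0 < m\<close> by simp
      then have "norm (\<Sum>i<k mod m. sc (f i x) (e i)) \<le> (\<Sum>i<k mod m. D * norm x)"
        using D by (intro sum_norm_le) auto
      also have "\<dots> \<le> m * (D * norm x)"
        using \<open>k mod m < m\<close> \<open>0 \<le> D\<close> by (simp add: mult_right_mono)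
      finally have "norm ((1 / real N) *\<^sub>R (\<Sum>i<k mod m. sc (f i x) (e i))) \<le> (m * D / N) * norm x"
        using \<open>0 < N\<close> by (simp add: field_simps)
      also have "\<dots> \<le> \<epsilon> * norm x" using N by (rule mult_right_mono) simp
      finally show "norm ((1 / real N) *\<^sub>R (\<Sum>i<k mod m. sc (f i x) (e i))) \<le> \<epsilon> * norm x" .
    qed
  qed
qed

end

section \<open>From Schauder frames to bounded approximation\<close>

context banach_over
begin

text \<open>
  The partial sums \<open>S n\<close> approximate the identity on a finite net of the compact set, and their
  common bound \<open>C\<close> carries the approximation over to the whole set.
\<close>

lemma bounded_approximation_of_frame:
  assumes "schauder_frame sc F"
  shows "bounded_approximation_property sc"
proof -
  have dual: "\<And>n. snd (F n) \<in> topological_dual sc"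
    and sums: "\<And>x. (\<lambda>n. sc (snd (F n) x) (fst (F n))) sums x"
    using assms unfolding schauder_frame_def by auto
  define S where "S n x = (\<Sum>i<n. sc (snd (F i) x) (fst (F i)))" for n x
  have add: "S n (x + y) = S n x + S n y" for n x y
    unfolding S_def sum.distrib[symmetric]
    using dual by (intro sum.cong) (auto simp: topological_dual_def Vector_Spaces.linear_iff scale_left_distrib)
  have scale: "S n (sc c x) = sc c (S n x)" for n c x
    unfolding S_def scale_sum_right
    using dual by (intro sum.cong) (auto simp: topological_dual_def Vector_Spaces.linear_iff)
  have linS: "Vector_Spaces.linear sc sc (S n)" for n
    unfolding Vector_Spaces.linear_iff by (auto simp: add scale vector_space_axioms)
  have lim: "(\<lambda>n. S n x) \<longlonglongrightarrow> x" for x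
    using sums[of x] unfolding S_def sums_def .
  have "\<exists>C>0. \<forall>n x. norm (S n x) \<le> C * norm x"
  proof (rule uniformly_bounded_of_pointwise_bounded)
    show "linear (S n)" for n by (rule linear_of_scalar_linear[OF linS])
    show "continuous_on UNIV (S n)" for n
      unfolding S_def using dual
      by (intro continuous_on_sum bounded_linear.continuous_on[OF bounded_linear_scale_left])
        (auto simp: topological_dual_def)
    show "\<exists>k. \<forall>n. norm (S n x) \<le> k" for x
      using convergent_imp_Bseq[OF convergentI[OF lim]] unfolding Bseq_def by blast
  qed
  then obtain C where "C > 0" and C: "\<And>n x. norm (S n x) \<le> C * norm x" by blast
  have blS: "bounded_linear (S n)" for n
    using linear_of_scalar_linear[OF linS] C
    by (intro bounded_linear_intro[where K = C]) (auto simp: linear_add linear_scale mult.commute)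
  have finite_rank: "finite_rank_operator sc (S n)" for n
  proof (rule finite_rank_operatorI[OF linS blS])
    show "finite (fst ` F ` {..<n})" by simp
    show "range (S n) \<subseteq> span (fst ` F ` {..<n})"
      unfolding S_def by (intro image_subsetI span_sum span_scale span_base) auto
  qed
  have onorm: "onorm (S n) \<le> max 1 C" for n
    using C \<open>C > 0\<close> by (intro order_trans[OF onorm_bound[of C]]) auto
  have "\<exists>n. \<forall>x\<in>K. norm (S n x - x) \<le> \<epsilon>" if "compact K" "\<epsilon> > 0" for K and \<epsilon> :: real
  proof -
    (* For q in the net near x, S n x - x splits into three parts of sizes C * r, r and r. *)
    define r where "r = \<epsilon> / (C + 2)"
    have "r > 0" using \<open>\<epsilon> > 0\<close> \<open>C > 0\<close> by (simp add: r_def)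
    then obtain Q where "finite Q" and Q: "K \<subseteq> (\<Union>q\<in>Q. ball q r)"
      using \<open>compact K\<close> compact_eq_totally_bounded by blast
    have "\<forall>\<^sub>F n in sequentially. dist (S n q) q < r" for q
      using lim \<open>r > 0\<close> by (rule tendstoD)
    then have "\<forall>\<^sub>F n in sequentially. \<forall>q\<in>Q. dist (S n q) q < r"
      using \<open>finite Q\<close> by (simp add: eventually_ball_finite_distrib)
    then obtain n where n: "\<forall>q\<in>Q. dist (S n q) q < r"
      using eventually_happens'[OF sequentially_bot] by blast
    have "norm (S n x - x) \<le> \<epsilon>" if "x \<in> K" for x
    proof -
      obtain q where q: "q \<in> Q" "dist q x < r" using Q \<open>x \<in> K\<close> by auto
      have "S n x - x = S n (x - q) + (S n q - q) + (q - x)"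
        using linear_diff[OF bounded_linear.linear[OF blS], of n x q] by simp
      then have "norm (S n x - x) \<le> norm (S n (x - q)) + norm (S n q - q) + norm (q - x)"
        by (metis add.commute add_left_mono norm_triangle_ineq norm_triangle_le)
      also have "\<dots> \<le> C * r + r + r"
      proof (intro add_mono)
        have "norm (S n (x - q)) \<le> C * norm (x - q)" by (rule C)
        also have "\<dots> \<le> C * r"
          using q \<open>C > 0\<close> by (intro mult_left_mono) (auto simp: dist_norm norm_minus_commute)
        finally show "norm (S n (x - q)) \<le> C * r" .
      qed (use n q in \<open>auto simp: dist_norm less_imp_le\<close>)
      also have "\<dots> = (C + 2) * r" by (simp add: algebra_simps)
      also have "\<dots> = \<epsilon>" using \<open>C > 0\<close> by (simp add: r_def)
      finally show ?thesis .
    qed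
    then show ?thesis by blast
  qed
  then show ?thesis
    unfolding bounded_approximation_property_def
    using finite_rank onorm by (intro exI[of _ "max 1 C"]) (meson max.cobounded1)
qed

end

section \<open>From bounded approximation to Schauder frames\<close>

text \<open>
  \<open>T n\<close> is chosen close to the identity on the first \<open>n + 1\<close> points of a dense sequence, and the
  common norm bound extends the convergence from the dense sequence to every point.
\<close>

lemma (in banach_over) pointwise_approximating_sequence:
  assumes "bounded_approximation_property sc"
    and "separable_space (euclidean :: 'a topology)"
  obtains T where "\<And>n. finite_rank_operator sc (T n)" "\<And>x. (\<lambda>n. T n x) \<longlonglongrightarrow> x"
proof -
  obtain D :: "'a set" where "countable D" and dense: "closure D = UNIV"
    using assms(2) unfolding separable_space_def by auto
  have "D \<noteq> {}" using dense by auto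
  then obtain d :: "nat \<Rightarrow> 'a" where d: "range d = D"
    using \<open>countable D\<close> uncountable_def by blast
  obtain M where "M \<ge> 1" and M: "\<And>K \<epsilon>. compact K \<Longrightarrow> 0 < \<epsilon> \<Longrightarrow>
      \<exists>T. finite_rank_operator sc T \<and> onorm T \<le> M \<and> (\<forall>x\<in>K. norm (T x - x) \<le> \<epsilon>)"
    using assms(1) unfolding bounded_approximation_property_def by blast
  have "\<forall>n. \<exists>T. finite_rank_operator sc T \<and> onorm T \<le> M \<and>
      (\<forall>x\<in>d ` {..n}. norm (T x - x) \<le> 1 / real (Suc n))"
    by (intro allI M finite_imp_compact) auto
  then obtain T where T: "\<And>n. finite_rank_operator sc (T n)" "\<And>n. onorm (T n) \<le> M"
    and Td: "\<And>n j. j \<le> n \<Longrightarrow> norm (T n (d j) - d j) \<le> 1 / real (Suc n)"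
    by (metis atMost_iff imageI)
  have bl: "bounded_linear (T n)" for n using T(1) by (simp add: finite_rank_operator_def)
  have "(\<lambda>n. T n x) \<longlonglongrightarrow> x" for x
  proof (rule LIMSEQ_I)
    fix r :: real assume "0 < r"
    define s where "s = r / (M + 2)"
    have "s > 0" using \<open>0 < r\<close> \<open>M \<ge> 1\<close> by (simp add: s_def)
    then obtain j where j: "norm (d j - x) < s"
      using dense d closure_approachable[of x D] by (auto simp: dist_norm)
    obtain N :: nat where N: "1 / real (Suc N) < s"
      using \<open>s > 0\<close> nat_approx_posE by blast
    have "norm (T n x - x) < r" if "n \<ge> max j N" for n
    proof -
      have "T n x - x = T n (x - d j) + (T n (d j) - d j) + (d j - x)"
        using linear_diff[OF bounded_linear.linear[OF bl], of n x "d j"] by simp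
      then have "norm (T n x - x) \<le> norm (T n (x - d j)) + norm (T n (d j) - d j) + norm (d j - x)"
        by (metis add.commute add_left_mono norm_triangle_ineq norm_triangle_le)
      also have "\<dots> < M * s + s + s"
      proof (intro add_le_less_mono add_mono)
        have "norm (T n (x - d j)) \<le> onorm (T n) * norm (x - d j)" by (rule onorm[OF bl])
        also have "\<dots> \<le> M * s"
          using j T(2) \<open>M \<ge> 1\<close> by (intro mult_mono) (auto simp: norm_minus_commute)
        finally show "norm (T n (x - d j)) \<le> M * s" .
        have "norm (T n (d j) - d j) \<le> 1 / real (Suc n)" using Td that by simp
        also have "\<dots> \<le> 1 / real (Suc N)" using that by (simp add: frac_le)
        finally show "norm (T n (d j) - d j) \<le> s" using N by simp
      qed (rule j)
      also have "\<dots> = (M + 2) * s" by (simp add: algebra_simps)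
      also have "\<dots> = r" using \<open>M \<ge> 1\<close> by (simp add: s_def)
      finally show ?thesis .
    qed
    then show "\<exists>no. \<forall>n\<ge>no. norm (T n x - x) < r" by blast
  qed
  with T(1) show ?thesis by (rule that)
qed

context complete_banach_over
begin

text \<open>
  The differences of an approximating sequence are expanded with \<open>\<epsilon> = 1 / (n + 1)\<close> and the
  expansions are concatenated. That the partial sums within blocks tend to \<open>0\<close> uses both
  \<open>A n x \<longlonglongrightarrow> 0\<close> and the choice of \<open>\<epsilon>\<close>.
\<close>

lemma frame_of_bounded_approximation:
  assumes "bounded_approximation_property sc"
    and "separable_space (euclidean :: 'a topology)"
  shows "\<exists>F. schauder_frame sc F"
proof -
  obtain T where T: "\<And>n. finite_rank_operator sc (T n)" and Tlim: "\<And>x. (\<lambda>n. T n x) \<longlonglongrightarrow> x"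
    using pointwise_approximating_sequence[OF assms] by blast
  (* The leading zero operator makes the differences telescope: A 0 + ... + A (n - 1) = U n. *)
  define U where "U n = (case n of 0 \<Rightarrow> (\<lambda>x. 0) | Suc k \<Rightarrow> T k)" for n
  have U: "Vector_Spaces.linear sc sc (U n) \<and> bounded_linear (U n) \<and>
      (\<exists>B. finite B \<and> range (U n) \<subseteq> span B)" for n
  proof (cases n)
    case 0
    then show ?thesis
      by (auto simp: U_def Vector_Spaces.linear_iff vector_space_axioms span_zero)
  next
    case (Suc k)
    then show ?thesis using T[of k] by (auto simp: U_def finite_rank_operator_def)
  qed
  have Ulim: "(\<lambda>n. U n x) \<longlonglongrightarrow> x" for x
    using Tlim[of x] by (subst filterlim_sequentially_Suc[symmetric]) (simp add: U_def)
  define A where "A n x = U (Suc n) x - U n x" for n x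
  define slow_expansion where "slow_expansion n l e f \<longleftrightarrow> 0 < l \<and> (\<forall>i. f i \<in> topological_dual sc) \<and>
      (\<forall>x. A n x = (\<Sum>i<l. sc (f i x) (e i))) \<and>
      (\<forall>k x. k \<le> l \<longrightarrow> norm (\<Sum>i<k. sc (f i x) (e i)) \<le> norm (A n x) + 1 / real (Suc n) * norm x)"
    for n l :: nat and e f
  have "\<exists>l e f. slow_expansion n l e f" for n
  proof -
    obtain B B' where B: "finite B" "range (U n) \<subseteq> span B" "finite B'" "range (U (Suc n)) \<subseteq> span B'"
      using U by meson
    have lin: "Vector_Spaces.linear sc sc (A n)"
      using U[of n] U[of "Suc n"]
      by (auto simp: Vector_Spaces.linear_iff A_def scale_right_diff_distrib)
    have bl: "bounded_linear (A n)"
      unfolding A_def using U by (intro bounded_linear_sub) auto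
    have fin: "finite (B \<union> B')" using B by simp
    have "A n x \<in> span (B \<union> B')" for x
      unfolding A_def using B span_mono[of B "B \<union> B'"] span_mono[of B' "B \<union> B'"]
      by (intro span_diff) blast+
    then have ran: "range (A n) \<subseteq> span (B \<union> B')" by blast
    have "0 < 1 / real (Suc n)" by simp
    then obtain l :: nat and e f where "0 < l" "\<And>i. f i \<in> topological_dual sc"
      "\<And>x. A n x = (\<Sum>i<l. sc (f i x) (e i))"
      "\<And>k x. k \<le> l \<Longrightarrow> norm (\<Sum>i<k. sc (f i x) (e i)) \<le> norm (A n x) + 1 / real (Suc n) * norm x"
      by (rule finite_rank_expansion_small_partial_sums[OF lin bl fin ran]) (rule that)
    then have "slow_expansion n l e f" by (simp add: slow_expansion_def)
    then show ?thesis by blast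
  qed
  then obtain l e f where "\<And>n. slow_expansion n (l n) (e n) (f n)"
    by metis
  then have l: "\<And>n. 0 < l n"
    and f: "\<And>n i. f n i \<in> topological_dual sc"
    and A: "\<And>n x. A n x = (\<Sum>i<l n. sc (f n i x) (e n i))"
    and partial: "\<And>n k x. k \<le> l n \<Longrightarrow>
        norm (\<Sum>i<k. sc (f n i x) (e n i)) \<le> norm (A n x) + 1 / real (Suc n) * norm x"
    unfolding slow_expansion_def by blast+
  obtain F where F: "\<And>k. \<exists>n i. F k = (e n i, f n i)"
    and Fblock: "\<And>n i. i < l n \<Longrightarrow> F ((\<Sum>j<n. l j) + i) = (e n i, f n i)"
    by (rule concatenate_blocks[OF l, where P = "\<lambda>n i. (e n i, f n i)"]) (rule that)
  have "(\<lambda>k. sc (snd (F k) x) (fst (F k))) sums x" for x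
  proof (rule sums_of_block_sums[of l])
    define g where "g k = sc (snd (F k) x) (fst (F k))" for k
    have block: "(\<Sum>i<k. g ((\<Sum>j<n. l j) + i)) = (\<Sum>i<k. sc (f n i x) (e n i))"
      if "k \<le> l n" for n k
      using that by (intro sum.cong) (auto simp: g_def Fblock)
    have "(\<Sum>i<(\<Sum>j<n. l j). g i) = U n x" for n
    proof (induction n)
      case 0
      show ?case by (simp add: U_def)
    next
      case (Suc n)
      then show ?case by (simp add: sum_lessThan_add block A[symmetric]) (simp add: A_def)
    qed
    then show "(\<lambda>n. \<Sum>i<(\<Sum>j<n. l j). g i) \<longlonglongrightarrow> x" using Ulim by simp
    show "norm (\<Sum>i<k. g ((\<Sum>j<n. l j) + i)) \<le> norm (A n x) + 1 / real (Suc n) * norm x"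
      if "k \<le> l n" for n k
      using partial[OF that] block[OF that] by simp
    have Alim: "(\<lambda>n. A n x) \<longlonglongrightarrow> x - x"
      unfolding A_def using Ulim by (intro tendsto_diff LIMSEQ_Suc)
    have lim0: "(\<lambda>n. 1 / real (Suc n)) \<longlonglongrightarrow> 0"
      using LIMSEQ_inverse_real_of_nat by (simp add: inverse_eq_divide)
    show "(\<lambda>n. norm (A n x) + 1 / real (Suc n) * norm x) \<longlonglongrightarrow> 0"
      using tendsto_add[OF tendsto_norm[OF Alim] tendsto_mult_right[OF lim0, of "norm x"]] by simp
  qed (rule l)
  moreover have "snd (F k) \<in> topological_dual sc" for k
    using F[of k] f by auto
  ultimately show ?thesis unfolding schauder_frame_def by blast
qed

lemma schauder_frame_iff_bounded_approximation:
  assumes "separable_space (euclidean :: 'a topology)"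
  shows "(\<exists>F. schauder_frame sc F) \<longleftrightarrow> bounded_approximation_property sc"
  using bounded_approximation_of_frame frame_of_bounded_approximation[OF _ assms] by blast

end

theorem theorem3:
  shows "(\<forall>sc :: real \<Rightarrow> 'a::banach \<Rightarrow> 'a.
            banach_over sc \<longrightarrow> separable_space (euclidean :: 'a topology) \<longrightarrow>
            ((\<exists>F. schauder_frame sc F) \<longleftrightarrow> bounded_approximation_property sc)) \<and>
         (\<forall>sc :: complex \<Rightarrow> 'b::banach \<Rightarrow> 'b.
            banach_over sc \<longrightarrow> separable_space (euclidean :: 'b topology) \<longrightarrow>
            ((\<exists>F. schauder_frame sc F) \<longleftrightarrow> bounded_approximation_property sc))"
  by (intro conjI allI impI complete_banach_over.schauder_frame_iff_bounded_approximation
      complete_banach_over.intro)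

end
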